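(* Let $\mathcal{A},\mathcal{X},\mathcal{L}$ be sets and let $\Phi:\mathcal{A}\times\mathcal{X}\to\mathcal{L}$ be a lunar map. Then the Hankel system $\{\Gamma_\ell^\Phi\}_{\ell\in\mathcal{L}}\subset B(\ell^2(\mathcal{X}),\ell^2(\mathcal{A}))$ has the self-absorption property (SAP).
   Context: Lunar map: $\Phi:\mathcal{A}\times\mathcal{X}\to\mathcal{L}$ is lunar if (i) it is coordinatewise injective, i.e. $\Phi(a,\cdot)$ is injective on $\mathcal{X}$ for each $a\in\mathcal{A}$ and $\Phi(\cdot,x)$ is injective on $\mathcal{A}$ for each $x\in\mathcal{X}$; and (ii) for all $a,b,c,d\in\mathcal{A}$ and $x,y,z,w\in\mathcal{X}$, $$\big(\Phi(a,x)=\Phi(b,y),\ \Phi(c,x)=\Phi(d,y),\ \Phi(a,z)=\Phi(b,w)\big)\Longrightarrow \Phi(c,z)=\Phi(d,w).$$ Hankel system of $\Phi$: $\Gamma_\ell^\Phi\in B(\ell^2(\mathcal{X}),\ell^2(\mathcal{A}))$ is the operator with matrix $\Gamma_\ell^\Phi(a,x)=1$ if $\Phi(a,x)=\ell$ and $0$ otherwise, $(a,x)\in\mathcal{A}\times\mathcal{X}$. SAP: a family $\{x_i\}_{i\in I}$ in an operator space $A$ (for instance $A=B(\ell^2(\mathcal{X}),\ell^2(\mathcal{A}))$ or a $C^*$-algebra) has the self-absorption property (SAP) if for every $C^*$-algebra $B$ and every finitely supported family $(b_i)_{i\in I}$ in $B$, $$\Big\|\sum_{i} b_i\otimes x_i\Big\|_{B\otimes_{\min}A}=\Big\|\sum_{i}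 b_i\otimes x_i\otimes\overline{x}_i\Big\|_{B\otimes_{\min}A\otimes_{\min}\overline{A}} .$$ Here $\otimes_{\min}$ is the minimal tensor product and $\overline{A}$ is the complex conjugate of $A$, with $\overline{x}$ being $x$ viewed in $\overline{A}$; for operators between $\ell^2$-spaces, $\overline{x}$ is identified with the entrywise complex conjugate matrix of $x$. *)

theory Defs
  imports "HOL-Analysis.Analysis"
begin

text \<open>C*-algebras, not necessarily unital.\<close>

class cstar_algebra = real_normed_algebra + banach +
  fixes scaleC :: "complex \<Rightarrow> 'a \<Rightarrow> 'a"
    and star :: "'a \<Rightarrow> 'a"
  assumes scaleC_add_right: "scaleC z (a + b) = scaleC z a + scaleC z b"
    and scaleC_add_left: "scaleC (z + w) a = scaleC z a + scaleC w a"
    and scaleC_scaleC: "scaleC z (scaleC w a) = scaleC (z * w) a"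
    and scaleC_of_real: "scaleC (complex_of_real r) a = scaleR r a"
    and scaleC_mult_left: "scaleC z a * b = scaleC z (a * b)"
    and scaleC_mult_right: "a * scaleC z b = scaleC z (a * b)"
    and norm_scaleC: "norm (scaleC z a) = cmod z * norm a"
    and star_add: "star (a + b) = star a + star b"
    and star_scaleC: "star (scaleC z a) = scaleC (cnj z) (star a)"
    and star_mult: "star (a * b) = star b * star a"
    and star_star: "star (star a) = a"
    and norm_star_mult_self: "norm (star a * a) = (norm a)\<^sup>2"

instantiation complex :: cstar_algebra
begin
definition scaleC_complex :: "complex \<Rightarrow> complex \<Rightarrow> complex"
  where "scaleC_complex z a = z * a"
definition star_complex :: "complex \<Rightarrow> complex"
  where "star_complex = cnj"
instance
  by standard
    (auto simp: scaleC_complex_def star_complex_def algebra_simps norm_mult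
      power2_eq_square scaleR_conv_of_real)
end


text \<open>The Hilbert space \<open>\<ell>\<^sup>2(S)\<close>, as functions vanishing off \<open>S\<close>.\<close>

definition ell2 :: "'s set \<Rightarrow> ('s \<Rightarrow> complex) set" where
  "ell2 S = {f. (\<forall>s. s \<notin> S \<longrightarrow> f s = 0) \<and> (\<lambda>s. (cmod (f s))\<^sup>2) summable_on S}"

definition ell2_norm :: "('s \<Rightarrow> complex) \<Rightarrow> real" where
  "ell2_norm f = sqrt (\<Sum>\<^sub>\<infinity>s. (cmod (f s))\<^sup>2)"

definition ell2_inner :: "('s \<Rightarrow> complex) \<Rightarrow> ('s \<Rightarrow> complex) \<Rightarrow> complex" where
  "ell2_inner f g = (\<Sum>\<^sub>\<infinity>s. cnj (f s) * g s)"

text \<open>Operators are represented by total functions, of which only the values on \<open>ell2 X\<close>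
  matter; every notion below depends on these values only.\<close>

type_synonym ('x, 'a) l2map = "('x \<Rightarrow> complex) \<Rightarrow> ('a \<Rightarrow> complex)"

definition bounded_ops :: "'x set \<Rightarrow> 'a set \<Rightarrow> ('x, 'a) l2map set" where
  "bounded_ops X A = {T.
     (\<forall>f \<in> ell2 X. T f \<in> ell2 A) \<and>
     (\<forall>f \<in> ell2 X. \<forall>g \<in> ell2 X. T (\<lambda>x. f x + g x) = (\<lambda>a. T f a + T g a)) \<and>
     (\<forall>z. \<forall>f \<in> ell2 X. T (\<lambda>x. z * f x) = (\<lambda>a. z * T f a)) \<and>
     (\<exists>C. \<forall>f \<in> ell2 X. ell2_norm (T f) \<le> C * ell2_norm f)}"

definition op_norm :: "'x set \<Rightarrow> ('x, 'a) l2map \<Rightarrow> real" where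
  "op_norm X T = (SUP f \<in> {f \<in> ell2 X. ell2_norm f \<le> 1}. ell2_norm (T f))"

definition matrix_op :: "'x set \<Rightarrow> 'a set \<Rightarrow> ('a \<Rightarrow> 'x \<Rightarrow> complex) \<Rightarrow> ('x, 'a) l2map" where
  "matrix_op X A M f = (\<lambda>a. if a \<in> A then (\<Sum>\<^sub>\<infinity>x\<in>X. M a x * f x) else 0)"

text \<open>The Hilbert space tensor product of \<open>T\<close> and \<open>S\<close>, under \<open>\<ell>\<^sup>2(X) \<otimes> \<ell>\<^sup>2(Y) = \<ell>\<^sup>2(X \<times> Y)\<close>,
  written out as the composition of \<open>1 \<otimes> S\<close> followed by \<open>T \<otimes> 1\<close>.\<close>

definition tensor_op ::
  "('x, 'a) l2map \<Rightarrow> ('y, 'b) l2map \<Rightarrow> ('x \<times> 'y, 'a \<times> 'b) l2map" where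
  "tensor_op T S f = (\<lambda>(a, b). T (\<lambda>x. S (\<lambda>y. f (x, y)) b) a)"

lemma tensor_op_elementary:
  assumes T: "T \<in> bounded_ops X A" and S: "S \<in> bounded_ops Y B"
    and u: "u \<in> ell2 X" and v: "v \<in> ell2 Y"
  shows "tensor_op T S (\<lambda>(x, y). u x * v y) = (\<lambda>(a, b). T u a * S v b)"
proof -
  have Sv: "S (\<lambda>y. z * v y) = (\<lambda>b. z * S v b)" for z
    using S v by (auto simp: bounded_ops_def)
  have Tu: "T (\<lambda>x. z * u x) = (\<lambda>a. z * T u a)" for z
    using T u by (auto simp: bounded_ops_def)
  have "T (\<lambda>x. u x * S v b) a = T u a * S v b" for a b
    using fun_cong[OF Tu[of "S v b"], of a] by (simp add: mult.commute)
  then show ?thesis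
    by (simp add: tensor_op_def Sv)
qed

text \<open>The operator whose matrix is the entrywise complex conjugate of that of \<open>T\<close>.\<close>

definition conj_op :: "('x, 'a) l2map \<Rightarrow> ('x, 'a) l2map" where
  "conj_op T f = (\<lambda>a. cnj (T (\<lambda>x. cnj (f x)) a))"


definition star_rep :: "'h set \<Rightarrow> ('b::cstar_algebra \<Rightarrow> ('h, 'h) l2map) \<Rightarrow> bool" where
  "star_rep H \<pi> \<longleftrightarrow>
     (\<forall>b. \<pi> b \<in> bounded_ops H H) \<and>
     (\<forall>b c. \<forall>f \<in> ell2 H. \<pi> (b + c) f = (\<lambda>h. \<pi> b f h + \<pi> c f h)) \<and>
     (\<forall>z b. \<forall>f \<in> ell2 H. \<pi> (scaleC z b) f = (\<lambda>h. z * \<pi> b f h)) \<and>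
     (\<forall>b c. \<forall>f \<in> ell2 H. \<pi> (b * c) f = \<pi> b (\<pi> c f)) \<and>
     (\<forall>b. \<forall>f \<in> ell2 H. \<forall>g \<in> ell2 H. ell2_inner (\<pi> (star b) f) g = ell2_inner f (\<pi> b g))"

text \<open>The norm of \<open>\<Sum>i\<in>J. b i \<otimes> y i\<close> in \<open>B \<otimes>\<^sub>m\<^sub>i\<^sub>n B(\<ell>\<^sup>2(X), \<ell>\<^sup>2(A))\<close>, for a finite set \<open>J\<close>:
  the supremum over the *-representations \<open>\<pi>\<close> of \<open>B\<close> of the norms of
  \<open>\<Sum>i\<in>J. \<pi> (b i) \<otimes> y i\<close> as an operator between Hilbert spaces. It suffices to let \<open>\<pi>\<close> act
  on \<open>\<ell>\<^sup>2\<close> of the underlying set of \<open>B\<close>: the direct sum of one GNS representation for each element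
  of \<open>B\<close> is faithful and has dimension at most the cardinality of \<open>B\<close>, and the supremum is attained
  at any faithful \<open>\<pi>\<close>. It is finite, as *-representations are contractive.\<close>

definition min_norm ::
  "'x set \<Rightarrow> 'i set \<Rightarrow> ('i \<Rightarrow> 'b::cstar_algebra) \<Rightarrow> ('i \<Rightarrow> ('x, 'a) l2map) \<Rightarrow> real" where
  "min_norm X J b y =
     (SUP \<pi> \<in> {\<pi> :: 'b \<Rightarrow> ('b, 'b) l2map. star_rep UNIV \<pi>}.
        op_norm (UNIV \<times> X) (\<lambda>f k. \<Sum>i\<in>J. tensor_op (\<pi> (b i)) (y i) f k))"

text \<open>The self-absorption property, tested against the C*-algebra \<open>'b\<close>. As HOL does not quantify
  over types inside a formula, "for every C*-algebra" is expressed by leaving \<open>'b\<close> a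
  type variable in theorems.\<close>

definition SAP ::
  "'b::cstar_algebra itself \<Rightarrow> 'x set \<Rightarrow> 'a set \<Rightarrow> 'i set \<Rightarrow> ('i \<Rightarrow> ('x, 'a) l2map) \<Rightarrow> bool" where
  "SAP B X A I x \<longleftrightarrow>
     (\<forall>i\<in>I. x i \<in> bounded_ops X A) \<and>
     (\<forall>b :: 'i \<Rightarrow> 'b. finite {i \<in> I. b i \<noteq> 0} \<longrightarrow>
        min_norm X {i \<in> I. b i \<noteq> 0} b x =
        min_norm (X \<times> X) {i \<in> I. b i \<noteq> 0} b (\<lambda>i. tensor_op (x i) (conj_op (x i))))"


definition lunar :: "'a set \<Rightarrow> 'x set \<Rightarrow> ('a \<times> 'x \<Rightarrow> 'l) \<Rightarrow> bool" where
  "lunar A X \<Phi> \<longleftrightarrow>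
     (\<forall>a\<in>A. inj_on (\<lambda>x. \<Phi> (a, x)) X) \<and>
     (\<forall>x\<in>X. inj_on (\<lambda>a. \<Phi> (a, x)) A) \<and>
     (\<forall>a\<in>A. \<forall>b\<in>A. \<forall>c\<in>A. \<forall>d\<in>A. \<forall>x\<in>X. \<forall>y\<in>X. \<forall>z\<in>X. \<forall>w\<in>X.
        \<Phi> (a, x) = \<Phi> (b, y) \<and> \<Phi> (c, x) = \<Phi> (d, y) \<and> \<Phi> (a, z) = \<Phi> (b, w) \<longrightarrow>
        \<Phi> (c, z) = \<Phi> (d, w))"

definition hankel :: "'a set \<Rightarrow> 'x set \<Rightarrow> ('a \<times> 'x \<Rightarrow> 'l) \<Rightarrow> 'l \<Rightarrow> ('x, 'a) l2map" where
  "hankel A X \<Phi> l = matrix_op X A (\<lambda>a x. if \<Phi> (a, x) = l then 1 else 0)"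

end

theory Submission imports Defs begin

text \<open>
  The two operator norms already agree for each *-representation \<open>\<pi>\<close> separately, and hence so do the
  suprema over \<open>\<pi>\<close>. Put \<open>T l = \<pi> (b l)\<close>. Then \<open>\<Sum>l. T l \<otimes> \<Gamma> l\<close> is the operator matrix with
  entry \<open>T (\<Phi> (a, x))\<close> at \<open>(a, x)\<close>, while \<open>\<Sum>l. T l \<otimes> \<Gamma> l \<otimes> conj (\<Gamma> l)\<close> has entry
  \<open>T (\<Phi> (a, x))\<close> at \<open>((a, b), (x, y))\<close> if \<open>\<Phi> (a, x) = \<Phi> (b, y)\<close>, and \<open>0\<close> otherwise.

  Consider the bipartite graph on \<open>A \<times> A\<close> and \<open>X \<times> X\<close> whose edges are the pairs with
  \<open>\<Phi> (a, x) = \<Phi> (b, y)\<close>. Condition (ii) of lunarity says that a path of length three can be closed up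
  by an edge; hence every connected component with an edge is complete bipartite, and the components
  can be recovered as the distinct neighbour sets (\<open>neighbours_eq_or_disjoint\<close>). The big matrix is
  the direct sum of the blocks that sit on the components. By coordinatewise injectivity, dropping
  the second coordinates is injective on both sides of a component, so each block is, up to
  relabelling, a submatrix of the small matrix, and its norm is at most the small norm
  (\<open>double_block\<close>). The norm of a direct sum is the supremum of the norms of its blocks
  (\<open>block_diagonal_bound\<close>), which gives one inequality. For the other one, injectivity again shows
  that \<open>(a, a)\<close> is adjacent only to diagonal pairs \<open>(x, x)\<close> and vice versa, so that the small matrix
  itself is one of the direct summands (\<open>double_diagonal\<close>).
\<close>

section \<open>Square-summable functions\<close>

lemma ell2_iff_summable:
  "f \<in> ell2 S \<longleftrightarrow> (\<forall>s. s \<notin> S \<longrightarrow> f s = 0) \<and> (\<lambda>s. (cmod (f s))\<^sup>2) summable_on UNIV"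
proof -
  have "(\<lambda>s. (cmod (f s))\<^sup>2) summable_on S \<longleftrightarrow> (\<lambda>s. (cmod (f s))\<^sup>2) summable_on UNIV"
    if "\<forall>s. s \<notin> S \<longrightarrow> f s = 0"
    by (rule summable_on_cong_neutral) (use that in auto)
  then show ?thesis
    by (auto simp: ell2_def)
qed

lemma ell2_norm_nonneg: "0 \<le> ell2_norm f"
  by (simp add: ell2_norm_def infsum_nonneg)

lemma ell2_norm_squared: "(ell2_norm f)\<^sup>2 = (\<Sum>\<^sub>\<infinity>s. (cmod (f s))\<^sup>2)"
  by (simp add: ell2_norm_def infsum_nonneg)

lemma sum_le_ell2_norm_squared:
  assumes "f \<in> ell2 S" "finite F"
  shows "(\<Sum>s\<in>F. (cmod (f s))\<^sup>2) \<le> (ell2_norm f)\<^sup>2"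
  unfolding ell2_norm_squared
  by (rule finite_sum_le_infsum) (use assms in \<open>auto simp: ell2_iff_summable\<close>)

text \<open>Sums of squares have nonnegative terms, so both membership in \<open>\<ell>\<^sup>2\<close> and a bound on the norm can be
  read off from the finite partial sums. Every norm estimate below is made on finite sums, which can
  be regrouped freely.\<close>

lemma ell2_boundI:
  assumes "0 \<le> c" and "\<And>s. s \<notin> S \<Longrightarrow> f s = 0"
    and bound: "\<And>F. finite F \<Longrightarrow> (\<Sum>s\<in>F. (cmod (f s))\<^sup>2) \<le> c\<^sup>2"
  shows "f \<in> ell2 S" and "ell2_norm f \<le> c"
proof -
  have summable: "(\<lambda>s. (cmod (f s))\<^sup>2) summable_on UNIV"
    by (rule nonneg_bdd_above_summable_on) (auto intro!: bdd_aboveI2[where M = "c\<^sup>2"] bound)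
  then show "f \<in> ell2 S"
    using assms by (simp add: ell2_iff_summable)
  have "(ell2_norm f)\<^sup>2 \<le> c\<^sup>2"
    unfolding ell2_norm_squared by (rule infsum_le_finite_sums[OF summable]) (rule bound)
  then show "ell2_norm f \<le> c"
    using \<open>0 \<le> c\<close> by (rule power2_le_imp_le)
qed

lemma zero_in_ell2: "(\<lambda>_. 0) \<in> ell2 S"
  by (simp add: ell2_iff_summable)

lemma ell2_norm_zero: "ell2_norm (\<lambda>_. 0) = 0"
  by (simp add: ell2_norm_def)

lemma ell2_scale:
  assumes "f \<in> ell2 S"
  shows "(\<lambda>s. z * f s) \<in> ell2 S"
  using assms by (auto simp: ell2_iff_summable norm_mult power_mult_distrib intro: summable_on_cmult_right)

lemma ell2_norm_scale: "ell2_norm (\<lambda>s. z * f s) = cmod z * ell2_norm f"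
  by (simp add: ell2_norm_def norm_mult power_mult_distrib infsum_cmult_right' real_sqrt_mult)

lemma ell2_add:
  assumes "f \<in> ell2 S" "g \<in> ell2 S"
  shows "(\<lambda>s. f s + g s) \<in> ell2 S"
proof -
  have sum_le: "(cmod (f s + g s))\<^sup>2 \<le> 2 * (cmod (f s))\<^sup>2 + 2 * (cmod (g s))\<^sup>2" for s
  proof -
    have "(cmod (f s + g s))\<^sup>2 \<le> (cmod (f s) + cmod (g s))\<^sup>2"
      by (intro power_mono norm_triangle_ineq norm_ge_zero)
    also have "\<dots> \<le> 2 * (cmod (f s))\<^sup>2 + 2 * (cmod (g s))\<^sup>2"
      using sum_squares_bound[of "cmod (f s)" "cmod (g s)"] by (simp add: power2_sum)
    finally show ?thesis .
  qed
  have "(\<lambda>s. 2 * (cmod (f s))\<^sup>2 + 2 * (cmod (g s))\<^sup>2) summable_on UNIV"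
    using assms unfolding ell2_iff_summable by (intro summable_on_add summable_on_cmult_right) simp_all
  then have "(\<lambda>s. (cmod (f s + g s))\<^sup>2) summable_on UNIV"
    by (rule summable_on_comparison_test) (simp_all add: sum_le)
  then show ?thesis
    using assms by (simp add: ell2_iff_summable)
qed

lemma ell2_sum:
  assumes "finite J" "\<And>j. j \<in> J \<Longrightarrow> f j \<in> ell2 S"
  shows "(\<lambda>s. \<Sum>j\<in>J. f j s) \<in> ell2 S"
  using assms by (induction J rule: finite_induct) (simp_all add: zero_in_ell2 ell2_add)

lemma ell2_norm_eq_0D:
  assumes "f \<in> ell2 S" "ell2_norm f = 0"
  shows "f s = 0"
  using sum_le_ell2_norm_squared[OF assms(1), of "{s}"] assms(2) by simp

text \<open>Restricting a function to the image of an injection \<open>j\<close> and relabelling along \<open>j\<close> is isometric.\<close>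

lemma ell2_relabel:
  assumes "inj_on j S" "\<And>s. s \<in> S \<Longrightarrow> v s = f (j s)" "\<And>s. s \<notin> S \<Longrightarrow> v s = 0"
  shows "v \<in> ell2 S \<longleftrightarrow> (\<lambda>t. (cmod (f t))\<^sup>2) summable_on j ` S"
    and "(ell2_norm v)\<^sup>2 = (\<Sum>\<^sub>\<infinity>t\<in>j ` S. (cmod (f t))\<^sup>2)"
proof -
  have "(\<lambda>t. (cmod (f t))\<^sup>2) summable_on j ` S \<longleftrightarrow> (\<lambda>s. (cmod (v s))\<^sup>2) summable_on S"
    using assms by (simp add: summable_on_reindex o_def cong: summable_on_cong)
  then show "v \<in> ell2 S \<longleftrightarrow> (\<lambda>t. (cmod (f t))\<^sup>2) summable_on j ` S"
    using assms by (auto simp: ell2_def)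
  have "(ell2_norm v)\<^sup>2 = (\<Sum>\<^sub>\<infinity>s\<in>S. (cmod (v s))\<^sup>2)"
    unfolding ell2_norm_squared by (rule infsum_cong_neutral) (use assms in auto)
  also have "\<dots> = (\<Sum>\<^sub>\<infinity>t\<in>j ` S. (cmod (f t))\<^sup>2)"
    using assms by (simp add: infsum_reindex o_def cong: infsum_cong)
  finally show "(ell2_norm v)\<^sup>2 = (\<Sum>\<^sub>\<infinity>t\<in>j ` S. (cmod (f t))\<^sup>2)" .
qed

lemma ell2_norm_diagonal:
  fixes v :: "'h \<times> 'p \<times> 'p \<Rightarrow> complex"
  assumes diagonal: "\<And>h p. v (h, p, p) = w (h, p)"
    and off_diagonal: "\<And>h p p'. p \<noteq> p' \<Longrightarrow> v (h, p, p') = 0"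
  shows "ell2_norm v = ell2_norm w"
proof -
  let ?j = "\<lambda>(h :: 'h, p :: 'p). (h, p, p)"
  have "(ell2_norm w)\<^sup>2 = (\<Sum>\<^sub>\<infinity>t\<in>range ?j. (cmod (v t))\<^sup>2)"
    by (rule ell2_relabel(2)) (auto simp: inj_on_def diagonal)
  also have "\<dots> = (ell2_norm v)\<^sup>2"
    unfolding ell2_norm_squared
  proof (rule infsum_cong_neutral)
    fix t assume t: "t \<in> UNIV - range ?j"
    obtain h p p' where t_eq: "t = (h, p, p')"
      by (cases t)
    with t have "p \<noteq> p'"
      by (auto simp: image_iff)
    then show "(cmod (v t))\<^sup>2 = 0"
      by (simp add: t_eq off_diagonal)
  qed auto
  finally show ?thesis
    by (simp add: ell2_norm_nonneg)
qed

lemma sum_infsum_disjoint_le: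
  fixes w :: "'t \<Rightarrow> real"
  assumes w: "w summable_on UNIV" "\<And>t. 0 \<le> w t"
    and "finite \<K>" "pairwise disjnt \<K>"
  shows "(\<Sum>K\<in>\<K>. infsum w K) \<le> infsum w UNIV"
proof -
  have summable: "w summable_on K" for K
    using w(1) by (rule summable_on_subset_banach) simp
  have "(\<Sum>K\<in>\<K>. infsum w K) = infsum w (\<Union>\<K>)"
    using assms(3,4)
  proof (induction \<K> rule: finite_induct)
    case (insert K \<K>)
    then have "K \<inter> \<Union>\<K> = {}"
      by (auto simp: pairwise_insert disjnt_def)
    with insert show ?case
      by (simp add: infsum_Un_disjoint[OF summable summable] pairwise_insert)
  qed simp
  also have "\<dots> \<le> infsum w UNIV"
    by (rule infsum_mono2) (use w summable in auto)
  finally show ?thesis .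
qed

text \<open>The norm of a direct sum of operators is bounded by the norms of the summands: an output
  coordinate \<open>s\<close> depends only on the input coordinates in \<open>D s\<close>, and coordinates with the same \<open>D s\<close> form
  one block. Using \<open>D s\<close> itself as the name of the block avoids choosing an index set for the blocks.
  The hypothesis is on finite parts of a block, so that no summability of \<open>u\<close> is presupposed.\<close>

lemma block_diagonal_bound:
  fixes f :: "'t \<Rightarrow> complex" and D :: "'s \<Rightarrow> 't set" and u :: "'s \<Rightarrow> complex"
  assumes f: "f \<in> ell2 S"
    and D: "\<And>s s'. D s = D s' \<or> D s \<inter> D s' = {}"
    and block: "\<And>K F. finite F \<Longrightarrow> (\<And>s. s \<in> F \<Longrightarrow> D s = K) \<Longrightarrow>
      (\<Sum>s\<in>F. (cmod (u s))\<^sup>2) \<le> c\<^sup>2 * (\<Sum>\<^sub>\<infinity>t\<in>K. (cmod (f t))\<^sup>2)"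
    and "finite F"
  shows "(\<Sum>s\<in>F. (cmod (u s))\<^sup>2) \<le> (c * ell2_norm f)\<^sup>2"
proof -
  have "(\<Sum>s\<in>F. (cmod (u s))\<^sup>2) = (\<Sum>K\<in>D ` F. \<Sum>s\<in>{s \<in> F. D s = K}. (cmod (u s))\<^sup>2)"
    using \<open>finite F\<close> by (rule sum.image_gen)
  also have "\<dots> \<le> (\<Sum>K\<in>D ` F. c\<^sup>2 * (\<Sum>\<^sub>\<infinity>t\<in>K. (cmod (f t))\<^sup>2))"
    by (intro sum_mono block) (use \<open>finite F\<close> in auto)
  also have "\<dots> = c\<^sup>2 * (\<Sum>K\<in>D ` F. \<Sum>\<^sub>\<infinity>t\<in>K. (cmod (f t))\<^sup>2)"
    by (simp add: sum_distrib_left)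
  also have "\<dots> \<le> c\<^sup>2 * (ell2_norm f)\<^sup>2"
    unfolding ell2_norm_squared
  proof (intro mult_left_mono sum_infsum_disjoint_le)
    show "pairwise disjnt (D ` F)"
      using D by (auto simp: pairwise_def disjnt_def)
  qed (use f \<open>finite F\<close> in \<open>auto simp: ell2_iff_summable\<close>)
  finally show ?thesis
    by (simp add: power_mult_distrib)
qed

lemma bound_on_unit_ball:
  assumes bound: "\<And>f. f \<in> ell2 S \<Longrightarrow> ell2_norm f \<le> 1 \<Longrightarrow> ell2_norm (V f) \<le> C"
    and hom: "\<And>z f. f \<in> ell2 S \<Longrightarrow> V (\<lambda>s. z * f s) = (\<lambda>t. z * V f t)"
    and f: "f \<in> ell2 S"
  shows "ell2_norm (V f) \<le> C * ell2_norm f"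
proof (cases "ell2_norm f = 0")
  case True
  then have "f = (\<lambda>s. 0 * f s)"
    using ell2_norm_eq_0D[OF f] by auto
  then have "V f = (\<lambda>t. 0)"
    using hom[OF f, of 0] by simp
  then show ?thesis
    using True by (simp add: ell2_norm_zero)
next
  case False
  define n where "n = ell2_norm f"
  have "0 < n"
    using False ell2_norm_nonneg[of f] by (simp add: n_def)
  have "ell2_norm (V (\<lambda>s. complex_of_real (1 / n) * f s)) \<le> C"
    by (rule bound[OF ell2_scale[OF f]], subst ell2_norm_scale)
      (use \<open>0 < n\<close> in \<open>simp add: n_def norm_divide\<close>)
  then have "1 / n * ell2_norm (V f) \<le> C"
    unfolding hom[OF f] ell2_norm_scale using \<open>0 < n\<close> by (simp add: norm_divide)
  then show ?thesis
    using \<open>0 < n\<close> by (simp add: field_simps flip: n_def)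
qed

text \<open>The supremum of a set of reals is defined as its least upper bound, chosen by description. Hence
  two sets with the same upper bounds have the same \<open>Sup\<close>, and comparing two operator norms amounts to
  transferring bounds on the unit ball from one operator to the other.\<close>

lemma op_norm_eqI:
  assumes "\<And>C. (\<forall>f\<in>ell2 S. ell2_norm f \<le> 1 \<longrightarrow> ell2_norm (V f) \<le> C) \<longleftrightarrow>
                (\<forall>f\<in>ell2 T. ell2_norm f \<le> 1 \<longrightarrow> ell2_norm (W f) \<le> C)"
  shows "op_norm S V = op_norm T W"
proof -
  have "(\<forall>r\<in>(\<lambda>f. ell2_norm (V f)) ` {f \<in> ell2 S. ell2_norm f \<le> 1}. r \<le> C) \<longleftrightarrow>
        (\<forall>r\<in>(\<lambda>f. ell2_norm (W f)) ` {f \<in> ell2 T. ell2_norm f \<le> 1}. r \<le> C)" for C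
    using assms[of C] by auto
  then show ?thesis
    by (simp add: op_norm_def Sup_real_def)
qed

section \<open>Operators given by partial injections\<close>

text \<open>A 0-1 matrix with at most one entry 1 in each row is composition with a partial function from rows
  to columns. The Hankel operators have this form, and it is preserved by \<open>\<Gamma> \<mapsto> \<Gamma> \<otimes> conj \<Gamma>\<close>,
  so that both families are treated alike.\<close>

definition pull :: "('p \<Rightarrow> 'q option) \<Rightarrow> ('q, 'p) l2map" where
  "pull \<rho> g p = (case \<rho> p of None \<Rightarrow> 0 | Some q \<Rightarrow> g q)"

definition pair_partial :: "('p \<Rightarrow> 'q option) \<Rightarrow> 'p \<times> 'p \<Rightarrow> ('q \<times> 'q) option" where
  "pair_partial \<rho> = (\<lambda>(p, p'). case (\<rho> p, \<rho> p') of (Some q, Some q') \<Rightarrow> Some (q, q') | _ \<Rightarrow> None)"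

lemma tensor_conj_pull: "tensor_op (pull \<rho>) (conj_op (pull \<rho>)) = pull (pair_partial \<rho>)"
  by (auto simp: fun_eq_iff tensor_op_def conj_op_def pull_def pair_partial_def split: option.splits)

lemma lunar_unique_column:
  assumes "lunar A X \<Phi>" "a \<in> A" "x \<in> X" "y \<in> X" "\<Phi> (a, x) = \<Phi> (a, y)"
  shows "x = y"
  using assms unfolding lunar_def inj_on_def by blast

lemma lunar_unique_row:
  assumes "lunar A X \<Phi>" "x \<in> X" "a \<in> A" "b \<in> A" "\<Phi> (a, x) = \<Phi> (b, x)"
  shows "a = b"
  using assms unfolding lunar_def inj_on_def by blast

definition partner :: "'a set \<Rightarrow> 'x set \<Rightarrow> ('a \<times> 'x \<Rightarrow> 'l) \<Rightarrow> 'l \<Rightarrow> 'a \<Rightarrow> 'x option" where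
  "partner A X \<Phi> l a =
     (if \<exists>x. a \<in> A \<and> x \<in> X \<and> \<Phi> (a, x) = l then Some (SOME x. x \<in> X \<and> \<Phi> (a, x) = l) else None)"

lemma partner_eq_Some_iff:
  assumes "lunar A X \<Phi>"
  shows "partner A X \<Phi> l a = Some x \<longleftrightarrow> a \<in> A \<and> x \<in> X \<and> \<Phi> (a, x) = l"
proof -
  have "(SOME x. x \<in> X \<and> \<Phi> (a, x) = l) = x" if "a \<in> A" "x \<in> X" "\<Phi> (a, x) = l" for x
    using that by (intro some_equality) (auto intro: lunar_unique_column[OF assms])
  then show ?thesis
    by (auto simp: partner_def)
qed

lemma partner_eq_None_iff:
  "partner A X \<Phi> l a = None \<longleftrightarrow> \<not> (\<exists>x. a \<in> A \<and> x \<in> X \<and> \<Phi> (a, x) = l)"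
  by (simp add: partner_def)

lemma partner_inj:
  assumes "lunar A X \<Phi>" "partner A X \<Phi> l a = Some x" "partner A X \<Phi> l b = Some x"
  shows "a = b"
  using assms(2,3) unfolding partner_eq_Some_iff[OF assms(1)]
  by (auto intro: lunar_unique_row[OF assms(1)])

lemma hankel_eq_pull:
  assumes "lunar A X \<Phi>"
  shows "hankel A X \<Phi> l = pull (partner A X \<Phi> l)"
proof (intro ext)
  fix f a
  show "hankel A X \<Phi> l f a = pull (partner A X \<Phi> l) f a"
  proof (cases "partner A X \<Phi> l a")
    case None
    then have "(\<Sum>\<^sub>\<infinity>x\<in>X. (if \<Phi> (a, x) = l then 1 else 0) * f x) = 0" if "a \<in> A"
      using that by (intro infsum_0) (auto simp: partner_eq_None_iff)
    with None show ?thesis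
      by (simp add: hankel_def matrix_op_def pull_def)
  next
    case (Some x)
    then have x: "a \<in> A" "x \<in> X" "\<Phi> (a, x) = l"
      by (simp_all add: partner_eq_Some_iff[OF assms])
    have "(\<Sum>\<^sub>\<infinity>x\<in>X. (if \<Phi> (a, x) = l then 1 else 0) * f x) = (\<Sum>\<^sub>\<infinity>x\<in>{x}. f x)"
    proof (rule infsum_cong_neutral)
      fix y assume "y \<in> X - {x}"
      then have "\<Phi> (a, y) \<noteq> l"
        using lunar_unique_column[OF assms, of a x y] x by auto
      then show "(if \<Phi> (a, y) = l then 1 else 0) * f y = 0"
        by simp
    qed (use x in auto)
    with x Some show ?thesis
      by (simp add: hankel_def matrix_op_def pull_def)
  qed
qed

text \<open>With at most one entry 1 in each column too, the operator is block diagonal with blocks of size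
  one, hence a contraction.\<close>

lemma pull_in_bounded_ops:
  assumes ran: "\<And>p q. \<rho> p = Some q \<Longrightarrow> p \<in> P \<and> q \<in> Q"
    and inj: "\<And>p p' q. \<rho> p = Some q \<Longrightarrow> \<rho> p' = Some q \<Longrightarrow> p = p'"
  shows "pull \<rho> \<in> bounded_ops Q P"
proof -
  have bound: "pull \<rho> f \<in> ell2 P \<and> ell2_norm (pull \<rho> f) \<le> 1 * ell2_norm f" if f: "f \<in> ell2 Q" for f
  proof -
    have "(\<Sum>p\<in>F. (cmod (pull \<rho> f p))\<^sup>2) \<le> (1 * ell2_norm f)\<^sup>2" if "finite F" for F
    proof (rule block_diagonal_bound[OF f _ _ that])
      show "set_option (\<rho> p) = set_option (\<rho> p') \<or> set_option (\<rho> p) \<inter> set_option (\<rho> p') = {}"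
        for p p' by (cases "\<rho> p"; cases "\<rho> p'") auto
    next
      fix K G assume G: "finite G" "\<And>p. p \<in> G \<Longrightarrow> set_option (\<rho> p) = K"
      show "(\<Sum>p\<in>G. (cmod (pull \<rho> f p))\<^sup>2) \<le> 1\<^sup>2 * (\<Sum>\<^sub>\<infinity>q\<in>K. (cmod (f q))\<^sup>2)"
      proof (cases "\<exists>p q. p \<in> G \<and> \<rho> p = Some q")
        case True
        then obtain p q where pq: "p \<in> G" "\<rho> p = Some q" by blast
        then have "K = {q}"
          using G(2)[of p] by auto
        have "p' = p" if "p' \<in> G" for p'
          using G(2)[OF that] \<open>K = {q}\<close> pq inj[of p' q p] by (cases "\<rho> p'") auto
        with pq have "G = {p}" by blast
        with \<open>K = {q}\<close> pq show ?thesis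
          by (simp add: pull_def)
      next
        case False
        then have "\<rho> p = None" if "p \<in> G" for p
          using that by (cases "\<rho> p") auto
        then have "(\<Sum>p\<in>G. (cmod (pull \<rho> f p))\<^sup>2) = 0"
          by (simp add: pull_def)
        then show ?thesis
          by (simp add: infsum_nonneg)
      qed
    qed
    moreover have "pull \<rho> f p = 0" if "p \<notin> P" for p
      using that ran[of p] by (auto simp: pull_def split: option.split)
    ultimately show ?thesis
      using ell2_boundI[of "1 * ell2_norm f" P "pull \<rho> f"] by (simp add: ell2_norm_nonneg)
  qed
  have "\<exists>C. \<forall>f\<in>ell2 Q. ell2_norm (pull \<rho> f) \<le> C * ell2_norm f"
    using bound by blast
  with bound show ?thesis
    by (auto simp: bounded_ops_def pull_def fun_eq_iff split: option.splits)
qed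

section \<open>Operator coefficients\<close>

text \<open>This is \<open>\<Sum>l\<in>J. T l \<otimes> pull (\<rho> l)\<close>, in the form to which the definition of \<open>tensor_op\<close> unfolds.\<close>

definition pull_sum ::
  "'l set \<Rightarrow> ('l \<Rightarrow> ('h, 'h) l2map) \<Rightarrow> ('l \<Rightarrow> 'p \<Rightarrow> 'q option) \<Rightarrow> ('h \<times> 'q, 'h \<times> 'p) l2map" where
  "pull_sum J T \<rho> f = (\<lambda>(h, p). \<Sum>l\<in>J. T l (\<lambda>h'. pull (\<rho> l) (\<lambda>q. f (h', q)) p) h)"

lemma bounded_ops_scale:
  assumes "T \<in> bounded_ops X A" "f \<in> ell2 X"
  shows "T (\<lambda>x. z * f x) = (\<lambda>a. z * T f a)"
  using assms by (simp add: bounded_ops_def)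

lemma bounded_ops_zero:
  assumes "T \<in> bounded_ops X A"
  shows "T (\<lambda>_. 0) = (\<lambda>_. 0)"
  using bounded_ops_scale[OF assms zero_in_ell2, of 0] by simp

lemma bounded_ops_nonneg_bound:
  assumes "T \<in> bounded_ops X A"
  obtains C where "0 \<le> C" "\<And>f. f \<in> ell2 X \<Longrightarrow> ell2_norm (T f) \<le> C * ell2_norm f"
proof -
  obtain C where C: "\<And>f. f \<in> ell2 X \<Longrightarrow> ell2_norm (T f) \<le> C * ell2_norm f"
    using assms unfolding bounded_ops_def by blast
  have "ell2_norm (T f) \<le> \<bar>C\<bar> * ell2_norm f" if "f \<in> ell2 X" for f
    using C[OF that] mult_right_mono[OF abs_ge_self[of C] ell2_norm_nonneg[of f]] by linarith
  then show thesis
    using that[of "\<bar>C\<bar>"] by simp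
qed

lemma ell2_slice:
  assumes "f \<in> ell2 (UNIV \<times> Q)"
  shows "(\<lambda>h. f (h, q)) \<in> ell2 UNIV"
    and "(ell2_norm (\<lambda>h. f (h, q)))\<^sup>2 = (\<Sum>\<^sub>\<infinity>t\<in>UNIV \<times> {q}. (cmod (f t))\<^sup>2)"
proof -
  have range: "range (\<lambda>h. (h, q)) = UNIV \<times> {q}"
    by auto
  have "(\<lambda>t. (cmod (f t))\<^sup>2) summable_on UNIV \<times> {q}"
    using assms by (auto simp: ell2_iff_summable intro: summable_on_subset_banach)
  then show "(\<lambda>h. f (h, q)) \<in> ell2 UNIV"
    and "(ell2_norm (\<lambda>h. f (h, q)))\<^sup>2 = (\<Sum>\<^sub>\<infinity>t\<in>UNIV \<times> {q}. (cmod (f t))\<^sup>2)"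
    using ell2_relabel[where j = "\<lambda>h. (h, q)" and S = UNIV and v = "\<lambda>h. f (h, q)" and f = f,
        unfolded range]
    by (simp_all add: inj_on_def)
qed

lemma pull_slice_in_ell2:
  assumes "f \<in> ell2 (UNIV \<times> Q)"
  shows "(\<lambda>h. pull \<rho> (\<lambda>q. f (h, q)) p) \<in> ell2 UNIV"
  by (cases "\<rho> p") (simp_all add: pull_def zero_in_ell2 ell2_slice[OF assms])

lemma pull_sum_scale:
  assumes T: "\<And>l. T l \<in> bounded_ops UNIV UNIV" and f: "f \<in> ell2 (UNIV \<times> Q)"
  shows "pull_sum J T \<rho> (\<lambda>s. z * f s) = (\<lambda>t. z * pull_sum J T \<rho> f t)"
proof -
  have pull_scale: "pull (\<rho> l) (\<lambda>q. z * f (h, q)) p = z * pull (\<rho> l) (\<lambda>q. f (h, q)) p" for l h p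
    by (simp add: pull_def split: option.split)
  have "T l (\<lambda>h. z * pull (\<rho> l) (\<lambda>q. f (h, q)) p) = (\<lambda>h. z * T l (\<lambda>h'. pull (\<rho> l) (\<lambda>q. f (h', q)) p) h)"
    for l p
    by (rule bounded_ops_scale[OF T pull_slice_in_ell2[OF f]])
  then show ?thesis
    by (auto simp: pull_sum_def pull_scale sum_distrib_left)
qed

text \<open>Each summand \<open>T l \<otimes> pull (\<rho> l)\<close> is block diagonal with copies of \<open>T l\<close> as blocks, one for each
  pair of indices matched by \<open>\<rho> l\<close>, and is therefore bounded by any bound of \<open>T l\<close>.\<close>

lemma pull_sum_in_ell2:
  fixes T :: "'l \<Rightarrow> ('h, 'h) l2map"
  assumes T: "\<And>l. T l \<in> bounded_ops UNIV UNIV" and "finite J"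
    and ran: "\<And>l p q. \<rho> l p = Some q \<Longrightarrow> p \<in> P"
    and inj: "\<And>l p p' q. \<rho> l p = Some q \<Longrightarrow> \<rho> l p' = Some q \<Longrightarrow> p = p'"
    and f: "f \<in> ell2 (UNIV \<times> Q)"
  shows "pull_sum J T \<rho> f \<in> ell2 (UNIV \<times> P)"
proof -
  have "(\<lambda>(h, p). T l (\<lambda>h'. pull (\<rho> l) (\<lambda>q. f (h', q)) p) h) \<in> ell2 (UNIV \<times> P)" for l
  proof -
    let ?u = "\<lambda>(h, p). T l (\<lambda>h'. pull (\<rho> l) (\<lambda>q. f (h', q)) p) h"
    obtain C where C: "0 \<le> C" "\<And>g. g \<in> ell2 UNIV \<Longrightarrow> ell2_norm (T l g) \<le> C * ell2_norm g"
      using bounded_ops_nonneg_bound[OF T] by metis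
    have T_ell2: "T l g \<in> ell2 UNIV" if "g \<in> ell2 UNIV" for g
      using T[of l] that by (simp add: bounded_ops_def)
    have u_None: "?u (h, p) = 0" if "\<rho> l p = None" for h p
      using that bounded_ops_zero[OF T, of l] by (simp add: pull_def)
    let ?D = "\<lambda>(h :: 'h, p). (UNIV :: 'h set) \<times> set_option (\<rho> l p)"
    have "(\<Sum>s\<in>F. (cmod (?u s))\<^sup>2) \<le> (C * ell2_norm f)\<^sup>2" if "finite F" for F
    proof (rule block_diagonal_bound[where D = ?D, OF f _ _ that])
      have "set_option (\<rho> l p) = set_option (\<rho> l p') \<or> set_option (\<rho> l p) \<inter> set_option (\<rho> l p') = {}"
        for p p' by (cases "\<rho> l p"; cases "\<rho> l p'") auto
      then show "?D s = ?D s' \<or> ?D s \<inter> ?D s' = {}" for s s'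
        by (cases s; cases s') (simp flip: Times_Int_distrib1, blast)
    next
      fix K G assume G: "finite G" "\<And>s. s \<in> G \<Longrightarrow> ?D s = K"
      show "(\<Sum>s\<in>G. (cmod (?u s))\<^sup>2) \<le> C\<^sup>2 * (\<Sum>\<^sub>\<infinity>t\<in>K. (cmod (f t))\<^sup>2)"
      proof (cases "\<exists>h p q. (h, p) \<in> G \<and> \<rho> l p = Some q")
        case True
        then obtain h p q where pq: "(h, p) \<in> G" "\<rho> l p = Some q" by blast
        then have K: "K = UNIV \<times> {q}"
          using G(2)[of "(h, p)"] by auto
        have snd: "p' = p" if "(h', p') \<in> G" for h' p'
          using G(2)[OF that] K pq inj[of l p' q p] by (cases "\<rho> l p'") auto
        let ?g = "\<lambda>h. f (h, q)"
        have g: "?g \<in> ell2 UNIV"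
          by (rule ell2_slice[OF f])
        have "(\<Sum>s\<in>G. (cmod (?u s))\<^sup>2) = (\<Sum>h\<in>fst ` G. (cmod (T l ?g h))\<^sup>2)"
        proof (subst sum.reindex)
          show "inj_on fst G"
            using snd by (auto simp: inj_on_def)
          show "(\<Sum>s\<in>G. (cmod (?u s))\<^sup>2) = sum ((\<lambda>h. (cmod (T l ?g h))\<^sup>2) \<circ> fst) G"
            using snd pq(2) by (intro sum.cong) (auto simp: pull_def)
        qed
        also have "\<dots> \<le> (ell2_norm (T l ?g))\<^sup>2"
          using T_ell2[OF g] G(1) by (intro sum_le_ell2_norm_squared) auto
        also have "\<dots> \<le> (C * ell2_norm ?g)\<^sup>2"
          by (intro power_mono C g ell2_norm_nonneg)
        also have "\<dots> = C\<^sup>2 * (\<Sum>\<^sub>\<infinity>t\<in>K. (cmod (f t))\<^sup>2)"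
          by (simp only: power_mult_distrib ell2_slice(2)[OF f] K)
        finally show ?thesis .
      next
        case False
        then have "\<rho> l p = None" if "(h, p) \<in> G" for h p
          using that by (cases "\<rho> l p") auto
        then have "?u s = 0" if "s \<in> G" for s
          using that u_None by (cases s) auto
        then have "(\<Sum>s\<in>G. (cmod (?u s))\<^sup>2) = 0"
          by simp
        then show ?thesis
          by (simp add: infsum_nonneg)
      qed
    qed
    moreover have "?u s = 0" if "s \<notin> UNIV \<times> P" for s
    proof -
      obtain h p where s: "s = (h, p)" by (cases s)
      with that ran[of l p] have "\<rho> l p = None"
        by (cases "\<rho> l p") auto
      then show ?thesis
        unfolding s by (rule u_None)
    qed
    ultimately show ?thesis
      using C(1) by (intro ell2_boundI(1)[of "C * ell2_norm f"]) (auto simp: ell2_norm_nonneg)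
  qed
  from ell2_sum[OF \<open>finite J\<close> this] show ?thesis
    by (simp add: pull_sum_def case_prod_unfold)
qed

section \<open>Complete bipartite components\<close>

text \<open>The neighbours of \<open>(a, b)\<close> in the bipartite graph that carries the nonzero entries of the matrices
  \<open>\<Gamma> l \<otimes> conj (\<Gamma> l)\<close>.\<close>

definition neighbours :: "'a set \<Rightarrow> 'x set \<Rightarrow> ('a \<times> 'x \<Rightarrow> 'l) \<Rightarrow> 'a \<times> 'a \<Rightarrow> ('x \<times> 'x) set" where
  "neighbours A X \<Phi> = (\<lambda>(a, b).
     {(x, y). a \<in> A \<and> b \<in> A \<and> x \<in> X \<and> y \<in> X \<and> \<Phi> (a, x) = \<Phi> (b, y)})"

text \<open>If \<open>(a, b)\<close> and \<open>(c, d)\<close> share the neighbour \<open>(x, y)\<close>, then for every other neighbour \<open>(z, w)\<close> of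
  \<open>(a, b)\<close> the lunar condition supplies exactly the edge from \<open>(c, d)\<close> to \<open>(z, w)\<close>.\<close>

lemma neighbours_eq_or_disjoint:
  assumes "lunar A X \<Phi>"
  shows "neighbours A X \<Phi> p = neighbours A X \<Phi> p' \<or> neighbours A X \<Phi> p \<inter> neighbours A X \<Phi> p' = {}"
proof -
  have subset: "neighbours A X \<Phi> p \<subseteq> neighbours A X \<Phi> p'"
    if "q \<in> neighbours A X \<Phi> p" "q \<in> neighbours A X \<Phi> p'" for p p' q
  proof
    fix r assume r: "r \<in> neighbours A X \<Phi> p"
    obtain a b where p: "p = (a, b)" by (cases p)
    obtain c d where p': "p' = (c, d)" by (cases p')
    obtain x y where q: "q = (x, y)" by (cases q)
    obtain z w where rzw: "r = (z, w)" by (cases r)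
    have mem: "a \<in> A" "b \<in> A" "c \<in> A" "d \<in> A" "x \<in> X" "y \<in> X" "z \<in> X" "w \<in> X"
      and eqs: "\<Phi> (a, x) = \<Phi> (b, y)" "\<Phi> (c, x) = \<Phi> (d, y)" "\<Phi> (a, z) = \<Phi> (b, w)"
      using that r unfolding p p' q rzw by (simp_all add: neighbours_def)
    have "\<Phi> (c, z) = \<Phi> (d, w)"
      by (rule assms[unfolded lunar_def, THEN conjunct2, THEN conjunct2, rule_format, OF mem])
        (simp add: eqs)
    then show "r \<in> neighbours A X \<Phi> p'"
      using mem by (simp add: p' rzw neighbours_def)
  qed
  then show ?thesis
    by blast
qed

text \<open>The next two lemmas identify a component with a submatrix of the original index set
  \<open>A \<times> X\<close>: in it, the first coordinate of a pair determines the second, on the column side and on the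
  row side.\<close>

lemma neighbours_fst_inj:
  assumes "lunar A X \<Phi>" "(x, y) \<in> neighbours A X \<Phi> p" "(x, y') \<in> neighbours A X \<Phi> p"
  shows "y = y'"
  using assms(2,3) lunar_unique_column[OF assms(1)]
  by (auto simp: neighbours_def split: prod.splits)

lemma neighbours_eq_fst_inj:
  assumes "lunar A X \<Phi>" "neighbours A X \<Phi> (a, b) = neighbours A X \<Phi> (a, b')"
    "neighbours A X \<Phi> (a, b) \<noteq> {}"
  shows "b = b'"
proof -
  obtain x y where "(x, y) \<in> neighbours A X \<Phi> (a, b)" "(x, y) \<in> neighbours A X \<Phi> (a, b')"
    using assms(2,3) by fastforce
  then have "b \<in> A" "b' \<in> A" "y \<in> X" "\<Phi> (b, y) = \<Phi> (b', y)"
    by (auto simp: neighbours_def)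
  then show ?thesis
    using lunar_unique_row[OF assms(1)] by blast
qed

section \<open>The two norms\<close>

context
  fixes A :: "'a set" and X :: "'x set" and \<Phi> :: "'a \<times> 'x \<Rightarrow> 'l"
    and J :: "'l set" and T :: "'l \<Rightarrow> ('h, 'h) l2map"
  assumes lunar: "lunar A X \<Phi>" and J: "finite J" and T: "\<And>l. T l \<in> bounded_ops UNIV UNIV"
begin

abbreviation "single \<equiv> pull_sum J T (partner A X \<Phi>)"
abbreviation "double \<equiv> pull_sum J T (\<lambda>l. pair_partial (partner A X \<Phi> l))"

lemma single_in_ell2:
  assumes "f \<in> ell2 (UNIV \<times> X)"
  shows "single f \<in> ell2 (UNIV \<times> A)"
proof (rule pull_sum_in_ell2[OF T J _ _ assms])
  show "p \<in> A" if "partner A X \<Phi> l p = Some q" for l p q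
    using that by (simp add: partner_eq_Some_iff[OF lunar])
qed (rule partner_inj[OF lunar])

text \<open>Functions supported on the diagonal of \<open>X \<times> X\<close> are mapped to functions supported on the diagonal of
  \<open>A \<times> A\<close>, because a Hankel operator does not match two different rows with the same column.
  On the diagonal the big operator acts as the small one.\<close>

lemma double_diagonal:
  assumes f: "f \<in> ell2 (UNIV \<times> X)"
  obtains f' where "f' \<in> ell2 (UNIV \<times> X \<times> X)" "ell2_norm f' = ell2_norm f"
    "ell2_norm (double f') = ell2_norm (single f)"
proof
  define f' where "f' = (\<lambda>(h :: 'h, x, y). if x = y then f (h, x) else 0)"
  let ?j = "\<lambda>(h :: 'h, x). (h, x, x)"
  have f0: "f (h, x) = 0" if "x \<notin> X" for h x
    using f that by (simp add: ell2_iff_summable)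
  have "(\<lambda>t. (cmod (f' t))\<^sup>2) summable_on ?j ` (UNIV \<times> X)"
    by (subst ell2_relabel(1)[symmetric, where v = f]) (use f f0 in \<open>auto simp: inj_on_def f'_def\<close>)
  then have "(\<lambda>t. (cmod (f' t))\<^sup>2) summable_on UNIV"
    by (rule summable_on_cong_neutral[THEN iffD1, rotated -1]) (auto simp: f'_def f0 image_iff)
  then show "f' \<in> ell2 (UNIV \<times> X \<times> X)"
    by (auto simp: ell2_iff_summable f'_def f0)
  show "ell2_norm f' = ell2_norm f"
    by (rule ell2_norm_diagonal) (simp_all add: f'_def)
  show "ell2_norm (double f') = ell2_norm (single f)"
  proof (rule ell2_norm_diagonal)
    fix h :: 'h and a
    show "double f' (h, a, a) = single f (h, a)"
      by (auto simp: pull_sum_def pull_def pair_partial_def f'_def fun_eq_iff split: option.splits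
          intro!: sum.cong arg_cong[where f = "\<lambda>g. T _ g h"])
  next
    fix h :: 'h and a b :: 'a assume "a \<noteq> b"
    have "pull (pair_partial (partner A X \<Phi> l)) (\<lambda>q. f' (h, q)) (a, b) = 0" for l h
      using partner_inj[OF lunar, of l a _ b] \<open>a \<noteq> b\<close>
      by (auto simp: pull_def pair_partial_def f'_def split: option.splits)
    then show "double f' (h, a, b) = 0"
      by (simp add: pull_sum_def bounded_ops_zero[OF T])
  qed
qed

text \<open>The rows with neighbour set \<open>N\<close> see only the columns in \<open>N\<close>. Forgetting second coordinates
  turns \<open>f\<close> restricted to \<open>N\<close> into a function \<open>g\<close> on \<open>X\<close> of the same norm, and completeness of the
  component makes the big operator at \<open>(a, b)\<close> agree with the small operator applied to \<open>g\<close> at \<open>a\<close>.\<close>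

lemma double_block:
  assumes f: "f \<in> ell2 (UNIV \<times> X \<times> X)"
    and bound: "\<And>g. g \<in> ell2 (UNIV \<times> X) \<Longrightarrow> ell2_norm (single g) \<le> C * ell2_norm g"
    and "finite F" and F: "\<And>h a b. (h, a, b) \<in> F \<Longrightarrow> neighbours A X \<Phi> (a, b) = N"
  shows "(\<Sum>s\<in>F. (cmod (double f s))\<^sup>2) \<le> C\<^sup>2 * (\<Sum>\<^sub>\<infinity>t\<in>UNIV \<times> N. (cmod (f t))\<^sup>2)"
proof (cases "F = {} \<or> N = {}")
  case True
  have "double f (h, a, b) = 0" if "(h, a, b) \<in> F" for h a b
  proof -
    have "neighbours A X \<Phi> (a, b) = {}"
      using True F that by auto
    then have "pair_partial (partner A X \<Phi> l) (a, b) = None" for l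
      by (auto simp: pair_partial_def neighbours_def partner_eq_Some_iff[OF lunar] split: option.splits)
    then show ?thesis
      by (simp add: pull_sum_def pull_def bounded_ops_zero[OF T])
  qed
  then have "(\<Sum>s\<in>F. (cmod (double f s))\<^sup>2) = 0"
    by (auto intro!: sum.neutral)
  then show ?thesis
    by (simp add: infsum_nonneg)
next
  case False
  then obtain a0 b0 where N: "N = neighbours A X \<Phi> (a0, b0)"
    using F by fastforce
  have "N \<subseteq> X \<times> X"
    by (auto simp: N neighbours_def)
  define Y where "Y x = (THE y. (x, y) \<in> N)" for x
  have Y: "(x, y) \<in> N \<Longrightarrow> Y x = y" for x y
    unfolding Y_def using neighbours_fst_inj[OF lunar] N by (intro the_equality) auto
  define g where "g = (\<lambda>(h :: 'h, x). if x \<in> fst ` N then f (h, x, Y x) else 0)"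
  let ?j = "\<lambda>(h :: 'h, x). (h, x, Y x)"
  have image: "?j ` (UNIV \<times> fst ` N) = UNIV \<times> N"
    using Y by (force simp: image_iff)
  have "inj_on ?j (UNIV \<times> fst ` N)"
    by (auto simp: inj_on_def)
  note relabel = ell2_relabel[where j = ?j and S = "UNIV \<times> fst ` N" and v = g and f = f,
      OF this, unfolded image]
  have "(\<lambda>t. (cmod (f t))\<^sup>2) summable_on UNIV \<times> N"
    using f by (auto simp: ell2_iff_summable intro: summable_on_subset_banach)
  then have "g \<in> ell2 (UNIV \<times> fst ` N)"
    using relabel(1) by (auto simp: g_def)
  then have g: "g \<in> ell2 (UNIV \<times> X)"
    using \<open>N \<subseteq> X \<times> X\<close> by (force simp: ell2_iff_summable)
  have norm_g: "(ell2_norm g)\<^sup>2 = (\<Sum>\<^sub>\<infinity>t\<in>UNIV \<times> N. (cmod (f t))\<^sup>2)"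
    using relabel(2) by (auto simp: g_def)
  have double_eq: "double f (h, a, b) = single g (h, a)" if "(h, a, b) \<in> F" for h a b
  proof -
    have ab: "neighbours A X \<Phi> (a, b) = N"
      using F that by blast
    have AB: "a \<in> A" "b \<in> A"
      using ab False by (auto simp: neighbours_def)
    have "pull (pair_partial (partner A X \<Phi> l)) (\<lambda>q. f (h, q)) (a, b) =
        pull (partner A X \<Phi> l) (\<lambda>q. g (h, q)) a" for l h
    proof (cases "partner A X \<Phi> l a")
      case None
      then show ?thesis
        by (simp add: pull_def pair_partial_def)
    next
      case (Some x)
      then have x: "x \<in> X" "\<Phi> (a, x) = l"
        by (simp_all add: partner_eq_Some_iff[OF lunar])
      \<comment> \<open>All of \<open>N\<close> is adjacent to \<open>(a, b)\<close>, so \<open>x\<close> lies under \<open>N\<close> precisely when \<open>\<Gamma> l\<close> also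
        matches \<open>b\<close>, and then the matching column is the one that \<open>g\<close> reads.\<close>
      have N_iff: "(x, y) \<in> N \<longleftrightarrow> partner A X \<Phi> l b = Some y" for y
        using x AB unfolding ab[symmetric] partner_eq_Some_iff[OF lunar] neighbours_def by auto
      show ?thesis
      proof (cases "partner A X \<Phi> l b")
        case None
        then have "x \<notin> fst ` N"
          using N_iff by auto
        with None Some show ?thesis
          by (simp add: pull_def pair_partial_def g_def)
      next
        case (Some y)
        then have "(x, y) \<in> N"
          using N_iff by simp
        then have "x \<in> fst ` N" "Y x = y"
          using Y by force+
        with Some \<open>partner A X \<Phi> l a = Some x\<close> show ?thesis
          by (simp add: pull_def pair_partial_def g_def)
      qed
    qed
    then show ?thesis
      by (simp add: pull_sum_def)
  qed
  let ?k = "\<lambda>(h :: 'h, a :: 'a, b :: 'a). (h, a)"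
  have "inj_on ?k F"
  proof (rule inj_onI)
    fix s s' assume s: "s \<in> F" "s' \<in> F" and eq: "?k s = ?k s'"
    obtain h a b where s_eq: "s = (h, a, b)"
      by (cases s)
    with eq obtain b' where s'_eq: "s' = (h, a, b')"
      by (cases s') auto
    have "neighbours A X \<Phi> (a, b) = N" "neighbours A X \<Phi> (a, b') = N"
      using F s unfolding s_eq s'_eq by blast+
    then have "b = b'"
      using False by (intro neighbours_eq_fst_inj[OF lunar, of a]) auto
    then show "s = s'"
      by (simp add: s_eq s'_eq)
  qed
  then have "(\<Sum>s\<in>F. (cmod (double f s))\<^sup>2) = (\<Sum>t\<in>?k ` F. (cmod (single g t))\<^sup>2)"
    by (subst sum.reindex) (auto intro!: sum.cong simp: double_eq)
  also have "\<dots> \<le> (ell2_norm (single g))\<^sup>2"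
    using \<open>finite F\<close> by (intro sum_le_ell2_norm_squared[OF single_in_ell2[OF g]]) auto
  also have "\<dots> \<le> (C * ell2_norm g)\<^sup>2"
    by (intro power_mono bound g ell2_norm_nonneg)
  also have "\<dots> = C\<^sup>2 * (\<Sum>\<^sub>\<infinity>t\<in>UNIV \<times> N. (cmod (f t))\<^sup>2)"
    by (simp add: power_mult_distrib norm_g)
  finally show ?thesis .
qed

lemma op_norm_single_eq_double:
  "op_norm (UNIV \<times> X) single = op_norm (UNIV \<times> X \<times> X) double"
proof (rule op_norm_eqI, intro iffI ballI impI)
  fix C :: real and f :: "'h \<times> 'x \<times> 'x \<Rightarrow> complex"
  assume single: "\<forall>f\<in>ell2 (UNIV \<times> X). ell2_norm f \<le> 1 \<longrightarrow> ell2_norm (single f) \<le> C"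
    and f: "f \<in> ell2 (UNIV \<times> X \<times> X)" "ell2_norm f \<le> 1"
  \<comment> \<open>The zero function lies in the unit ball.\<close>
  have "0 \<le> C"
    using single[rule_format, OF zero_in_ell2] ell2_norm_nonneg[of "single (\<lambda>_. 0)"]
    by (simp add: ell2_norm_zero)
  have bound: "ell2_norm (single g) \<le> C * ell2_norm g" if "g \<in> ell2 (UNIV \<times> X)" for g
    by (rule bound_on_unit_ball[OF _ _ that]) (use single pull_sum_scale[OF T] in auto)
  let ?D = "\<lambda>(h :: 'h, p). (UNIV :: 'h set) \<times> neighbours A X \<Phi> p"
  have "ell2_norm (double f) \<le> C * ell2_norm f"
  proof (rule ell2_boundI(2)[where S = UNIV])
    show "(\<Sum>s\<in>F. (cmod (double f s))\<^sup>2) \<le> (C * ell2_norm f)\<^sup>2" if "finite F" for F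
    proof (rule block_diagonal_bound[where D = ?D, OF f(1) _ _ that])
      show "?D s = ?D s' \<or> ?D s \<inter> ?D s' = {}" for s s'
        using neighbours_eq_or_disjoint[OF lunar, of "snd s" "snd s'"]
        by (cases s; cases s') auto
    next
      fix K F assume F: "finite F" "\<And>s. s \<in> F \<Longrightarrow> ?D s = K"
      show "(\<Sum>s\<in>F. (cmod (double f s))\<^sup>2) \<le> C\<^sup>2 * (\<Sum>\<^sub>\<infinity>t\<in>K. (cmod (f t))\<^sup>2)"
      proof (cases "F = {}")
        case False
        then obtain h0 p0 where "(h0, p0) \<in> F"
          by auto
        then have K: "K = UNIV \<times> neighbours A X \<Phi> p0"
          using F(2) by fastforce
        have "neighbours A X \<Phi> (a, b) = neighbours A X \<Phi> p0" if "(h, a, b) \<in> F" for h a b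
          using F(2)[OF that] unfolding K by auto
        then show ?thesis
          unfolding K by (intro double_block f(1) bound F(1))
      qed (simp add: infsum_nonneg)
    qed
  qed (use \<open>0 \<le> C\<close> ell2_norm_nonneg[of f] in auto)
  also have "\<dots> \<le> C"
    using \<open>0 \<le> C\<close> f(2) by (simp add: mult_left_le)
  finally show "ell2_norm (double f) \<le> C" .
next
  fix C :: real and f :: "'h \<times> 'x \<Rightarrow> complex"
  assume double: "\<forall>f\<in>ell2 (UNIV \<times> X \<times> X). ell2_norm f \<le> 1 \<longrightarrow> ell2_norm (double f) \<le> C"
    and f: "f \<in> ell2 (UNIV \<times> X)" "ell2_norm f \<le> 1"
  obtain f' where "f' \<in> ell2 (UNIV \<times> X \<times> X)" "ell2_norm f' = ell2_norm f"
    "ell2_norm (double f') = ell2_norm (single f)"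
    using double_diagonal[OF f(1)] by blast
  with double f(2) show "ell2_norm (single f) \<le> C"
    by metis
qed

end

theorem theorem2:
  fixes A :: "'a set" and X :: "'x set" and L :: "'l set"
    and \<Phi> :: "'a \<times> 'x \<Rightarrow> 'l"
  assumes "\<Phi> \<in> A \<times> X \<rightarrow> L"
    and "lunar A X \<Phi>"
  shows "SAP TYPE('b::cstar_algebra) X A L (hankel A X \<Phi>)"
proof -
  have bounded: "hankel A X \<Phi> l \<in> bounded_ops X A" for l
    unfolding hankel_eq_pull[OF assms(2)]
  proof (rule pull_in_bounded_ops)
    show "a \<in> A \<and> x \<in> X" if "partner A X \<Phi> l a = Some x" for a x
      using that by (simp add: partner_eq_Some_iff[OF assms(2)])
  qed (rule partner_inj[OF assms(2)])
  have tensor_sum: "(\<lambda>f k. \<Sum>l\<in>J. tensor_op (T l) (pull (\<rho> l)) f k) = pull_sum J T \<rho>"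
    for J and T :: "'l \<Rightarrow> ('b, 'b) l2map" and \<rho> :: "'l \<Rightarrow> 'p \<Rightarrow> 'q option"
    by (auto simp: fun_eq_iff tensor_op_def pull_sum_def)
  have "min_norm X J b (hankel A X \<Phi>) =
      min_norm (X \<times> X) J b (\<lambda>l. tensor_op (hankel A X \<Phi> l) (conj_op (hankel A X \<Phi> l)))"
    if J: "finite J" for J and b :: "'l \<Rightarrow> 'b"
    unfolding min_norm_def hankel_eq_pull[OF assms(2)] tensor_conj_pull tensor_sum
  proof (rule SUP_cong)
    fix \<pi> :: "'b \<Rightarrow> ('b, 'b) l2map" assume "\<pi> \<in> {\<pi>. star_rep UNIV \<pi>}"
    then have "\<pi> (b l) \<in> bounded_ops UNIV UNIV" for l
      by (simp add: star_rep_def)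
    then show "op_norm (UNIV \<times> X) (pull_sum J (\<lambda>l. \<pi> (b l)) (partner A X \<Phi>)) =
      op_norm (UNIV \<times> X \<times> X) (pull_sum J (\<lambda>l. \<pi> (b l)) (\<lambda>l. pair_partial (partner A X \<Phi> l)))"
      by (rule op_norm_single_eq_double[OF assms(2) J])
  qed simp
  with bounded show ?thesis
    by (simp add: SAP_def)
qed

end
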